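(* For $(\mathrm{Epi}(\mathsf{FinSet}^{\mathrm{op}}),-/\mathrm{Epi}(\mathsf{FinSet}^{\mathrm{op}}))$: (1) the universal baseless $\mathsf{OrdCMon}$-entropy is the cardinality $|\cdot|:\mathrm{Epi}(\mathsf{FinSet}^{\mathrm{op}})\to\mathbb{Z}_{\ge0}$, and the same for $\mathsf{COrdCMon}$ and $\mathsf{IcOrdCMon}$; (2) the universal baseless $\mathsf{OrdAb}$-entropy is $|\cdot|:\mathrm{Epi}(\mathsf{FinSet}^{\mathrm{op}})\to\mathbb{Z}$, and the same for $\mathsf{IcOrdAb}$; (3) the universal baseless $\mathsf{OrdVect}_{\mathbb{Q}}$-entropy is $|\cdot|:\mathrm{Epi}(\mathsf{FinSet}^{\mathrm{op}})\to\mathbb{Q}$, and the same for $\mathsf{IcOrdVect}_{\mathbb{Q}}$.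
   Context: **The category.** $\mathsf{C}=\mathrm{Epi}(\mathsf{FinSet}^{\mathrm{op}})$ has finite sets as objects; a morphism $A\to B$ is an injective function $B\to A$. Tensor product: disjoint union $A\sqcup B$; unit $I=\emptyset$. The under category $A/\mathsf{C}$ has objects injective functions $f:B\to A$ (morphisms $A\to B$ of $\mathsf{C}$) and a morphism from $f:B\to A$ to $f':B'\to A$ is an injection $k:B'\to B$ with $fk=f'$. It is monoidal: the tensor product of injections $f:B\to A$, $g:C\to A$ is the inclusion $f(B)\cup g(C)\hookrightarrow A$; its unit $I_A$ is $\emptyset\to A$. **Codomains.** $\mathbb{Z}_{\ge0},\mathbb{Z},\mathbb{Q}$ carry addition and the usual order. $\mathsf{OrdCMon}$: partially ordered commutative monoids ($x\ge y,z\ge w\Rightarrow x+z\ge y+w$) and order-preserving homomorphisms; $\mathsf{COrdCMon}$: the full subcategory of cancellative ones ($x+z\ge y+z\Rightarrow x\ge y$); $\mathsf{IcOrdCMon}$: the full subcategory of integrally closed ones (if $nx+a\ge ny+b$ for all integers $n\ge1$ then $x\ge y$); $\mathsf{OrdAb}$: partially ordered abelian groups and order-preserving homomorphisms; $\mathsf{OrdVect}_{\mathbb{Q}}$: ordered $\mathbb{Q}$-vector spaces (translation-invariant partial order with $x\ge y\Rightarrow ax\ge ay$ for rational $a\ge0$) and order-preserving linear maps; $\mathsf{IcOrdAb}$, $\mathsf{IcOrdVect}_{\mathbb{Q}}$: the full subcategories of integrally closed objects. **Entropies.** For $\mathsf{V}$ one of these categories, a $\mathsf{V}$-entropy of $(\mathsf{C},-/\mathsf{C})$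 with values in $W\in\mathsf{V}$ is a monoidal natural transformation $h:-/\mathsf{C}\Rightarrow\Delta_W$ ($W$ viewed as a monoidal category with $a\to b$ iff $a\ge b$); unpacked: functions $h_P:\mathrm{Ob}(P/\mathsf{C})\to W$, $P\in\mathsf{C}$, such that (morphisms and composition being those of $\mathsf{C}$) (1) $h_P(X)\ge h_P(X')$ if there is a morphism $X\to X'$ in $P/\mathsf{C}$; (2) $h_P(X)+h_P(Y)\ge h_P(X\otimes_PY)$ and $0\ge h_P(I_P)$, with $\otimes_P$ the tensor product of $P/\mathsf{C}$; (3) $h_P(X\circ f)=h_Q(X)$ for $f:P\to Q$ in $\mathsf{C}$, $X\in Q/\mathsf{C}$; (4) $h_{P\otimes Q}(X\otimes Y)=h_P(X)+h_Q(Y)$ for $X\in P/\mathsf{C}$, $Y\in Q/\mathsf{C}$ ($\otimes$ the tensor product of $\mathsf{C}$), and $h_I(I_I)=0$. The corresponding baseless $\mathsf{V}$-entropy is $H(P)=h_P(\mathrm{id}_P)$ (so $h_P(X)=H(A)$ for $X:P\to A$ in $\mathsf{C}$). A baseless $\mathsf{V}$-entropy $H$ into $W$ is universal if for every baseless $\mathsf{V}$-entropy $H'$ into $W'\in\mathsf{V}$ there is a unique morphism $t:W\to W'$ in $\mathsf{V}$ with $H'=t\circ H$. *)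

theory Defs
  imports Complex_Main "HOL-Library.FuncSet"
begin

text \<open>Finite sets are finite subsets of a universe built freely from an arbitrary type of atoms and
  two tags. Every finite set of atoms is (a copy of) an object, and the universe is closed under
  the tagged disjoint union, so this is a small version of the monoidal category of all finite
  sets, for every choice of the type of atoms.\<close>

datatype 'a elem = Atom 'a | InL "'a elem" | InR "'a elem"

type_synonym 'a obj = "'a elem set"

type_synonym 'a arr = "'a elem \<Rightarrow> 'a elem"

definition Ob :: "'a obj set" where
  "Ob = {A. finite A}"

text \<open>A morphism from \<open>A\<close> to \<open>B\<close> is an injective function from \<open>B\<close> to \<open>A\<close>; outside \<open>B\<close> it is
  \<^const>\<open>undefined\<close>, so that equality of morphisms is equality in HOL.\<close>

definition Hom :: "'a obj \<Rightarrow> 'a obj \<Rightarrow> 'a arr set" where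
  "Hom A B = {f \<in> B \<rightarrow>\<^sub>E A. inj_on f B}"

definition Id :: "'a obj \<Rightarrow> 'a arr" where
  "Id A = (\<lambda>x\<in>A. x)"

text \<open>\<open>Comp C g f\<close> is the composite of \<open>f \<in> Hom A B\<close> followed by \<open>g \<in> Hom B C\<close>. Arrows being
  reversed, the underlying function applies \<open>g\<close> first.\<close>

definition Comp :: "'a obj \<Rightarrow> 'a arr \<Rightarrow> 'a arr \<Rightarrow> 'a arr" where
  "Comp C g f = compose C f g"

definition tensor_ob :: "'a obj \<Rightarrow> 'a obj \<Rightarrow> 'a obj" where
  "tensor_ob A B = InL ` A \<union> InR ` B"

definition unit_ob :: "'a obj" where
  "unit_ob = {}"

text \<open>The tensor product of \<open>f \<in> Hom P A\<close> and \<open>g \<in> Hom Q B\<close>, with the targets \<open>A\<close> and \<open>B\<close> given.\<close>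

definition tensor_arr :: "'a obj \<Rightarrow> 'a obj \<Rightarrow> 'a arr \<Rightarrow> 'a arr \<Rightarrow> 'a arr" where
  "tensor_arr A B f g = (\<lambda>z\<in>tensor_ob A B.
     case z of InL x \<Rightarrow> InL (f x) | InR y \<Rightarrow> InR (g y) | Atom a \<Rightarrow> undefined)"

text \<open>An object under \<open>P\<close> is a pair \<open>(B, f)\<close> with \<open>f \<in> Hom P B\<close>, i.e. an injection from \<open>B\<close> to \<open>P\<close>.\<close>

type_synonym 'a under = "'a obj \<times> 'a arr"

definition under_Ob :: "'a obj \<Rightarrow> 'a under set" where
  "under_Ob P = (SIGMA B:Ob. Hom P B)"

definition under_Hom :: "'a under \<Rightarrow> 'a under \<Rightarrow> 'a arr set" where
  "under_Hom X X' = {k \<in> Hom (fst X) (fst X'). Comp (fst X') k (snd X) = snd X'}"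

definition under_tensor :: "'a under \<Rightarrow> 'a under \<Rightarrow> 'a under" where
  "under_tensor X Y =
     (snd X ` fst X \<union> snd Y ` fst Y, \<lambda>x\<in>snd X ` fst X \<union> snd Y ` fst Y. x)"

definition under_unit :: "'a under" where
  "under_unit = ({}, \<lambda>x\<in>{}. x)"

definition under_id :: "'a obj \<Rightarrow> 'a under" where
  "under_id P = (P, Id P)"

definition precomp :: "'a under \<Rightarrow> 'a arr \<Rightarrow> 'a under" where
  "precomp X f = (fst X, Comp (fst X) (snd X) f)"

definition ext_tensor :: "'a under \<Rightarrow> 'a under \<Rightarrow> 'a under" where
  "ext_tensor X Y =
     (tensor_ob (fst X) (fst Y), tensor_arr (fst X) (fst Y) (snd X) (snd Y))"

definition entropy :: "('a obj \<Rightarrow> 'a under \<Rightarrow> 'w::ordered_comm_monoid_add) \<Rightarrow> bool" where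
  "entropy h \<longleftrightarrow>
     (\<forall>P\<in>Ob. \<forall>X\<in>under_Ob P. \<forall>X'\<in>under_Ob P. under_Hom X X' \<noteq> {} \<longrightarrow> h P X \<ge> h P X') \<and>
     (\<forall>P\<in>Ob. \<forall>X\<in>under_Ob P. \<forall>Y\<in>under_Ob P. h P X + h P Y \<ge> h P (under_tensor X Y)) \<and>
     (\<forall>P\<in>Ob. 0 \<ge> h P under_unit) \<and>
     (\<forall>P\<in>Ob. \<forall>Q\<in>Ob. \<forall>f\<in>Hom P Q. \<forall>X\<in>under_Ob Q. h P (precomp X f) = h Q X) \<and>
     (\<forall>P\<in>Ob. \<forall>Q\<in>Ob. \<forall>X\<in>under_Ob P. \<forall>Y\<in>under_Ob Q.
        h (tensor_ob P Q) (ext_tensor X Y) = h P X + h Q Y) \<and>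
     h unit_ob under_unit = 0"

definition baseless_entropy :: "('a obj \<Rightarrow> 'w::ordered_comm_monoid_add) \<Rightarrow> bool" where
  "baseless_entropy H \<longleftrightarrow> (\<exists>h. entropy h \<and> (\<forall>P\<in>Ob. H P = h P (under_id P)))"

text \<open>The objects of OrdCMon are the types of class \<^class>\<open>ordered_comm_monoid_add\<close>, those of OrdAb the
  types of class \<^class>\<open>ordered_ab_group_add\<close> (a subclass). The full subcategories are cut out by
  the following predicates.\<close>

definition cancellative :: "'w::ordered_comm_monoid_add itself \<Rightarrow> bool" where
  "cancellative _ \<longleftrightarrow> (\<forall>x y z :: 'w. x + z \<ge> y + z \<longrightarrow> x \<ge> y)"

text \<open>The multiple \<open>n x\<close> in a commutative monoid is written as a sum of \<open>n\<close> equal terms.\<close>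

definition integrally_closed :: "'w::ordered_comm_monoid_add itself \<Rightarrow> bool" where
  "integrally_closed _ \<longleftrightarrow>
     (\<forall>x y a b :: 'w. (\<forall>n::nat. n \<ge> 1 \<longrightarrow> (\<Sum>i<n. x) + a \<ge> (\<Sum>i<n. y) + b) \<longrightarrow> x \<ge> y)"

locale ordered_rat_vector_space = vector_space scale
  for scale :: "rat \<Rightarrow> 'w::ordered_ab_group_add \<Rightarrow> 'w" +
  assumes scale_mono: "a \<ge> 0 \<Longrightarrow> x \<ge> y \<Longrightarrow> scale a x \<ge> scale a y"

definition ord_cmon_hom ::
    "('v::ordered_comm_monoid_add \<Rightarrow> 'w::ordered_comm_monoid_add) \<Rightarrow> bool" where
  "ord_cmon_hom t \<longleftrightarrow> t 0 = 0 \<and> (\<forall>x y. t (x + y) = t x + t y) \<and> mono t"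

definition ord_ab_hom ::
    "('v::ordered_ab_group_add \<Rightarrow> 'w::ordered_ab_group_add) \<Rightarrow> bool" where
  "ord_ab_hom t \<longleftrightarrow> additive t \<and> mono t"

definition ord_vect_hom ::
    "(rat \<Rightarrow> 'v \<Rightarrow> 'v) \<Rightarrow> (rat \<Rightarrow> 'w \<Rightarrow> 'w) \<Rightarrow>
     ('v::ordered_ab_group_add \<Rightarrow> 'w::ordered_ab_group_add) \<Rightarrow> bool" where
  "ord_vect_hom s s' t \<longleftrightarrow> Vector_Spaces.linear s s' t \<and> mono t"

text \<open>In \<open>initial_for Mor H\<close> the predicate \<open>Mor\<close> singles out the morphisms of the codomain category
  from the target \<open>'v\<close> of \<open>H\<close> to \<open>'w\<close>. Universality quantifies over all codomains: below, \<open>'w\<close> is a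
  type argument, to be left as a type variable in a theorem.\<close>

definition initial_for ::
    "(('v \<Rightarrow> 'w::ordered_comm_monoid_add) \<Rightarrow> bool) \<Rightarrow> ('a obj \<Rightarrow> 'v) \<Rightarrow> bool" where
  "initial_for Mor H \<longleftrightarrow>
     (\<forall>H'. baseless_entropy H' \<longrightarrow> (\<exists>!t. Mor t \<and> (\<forall>P\<in>Ob. H' P = t (H P))))"

definition universal_OrdCMon ::
    "('a obj \<Rightarrow> 'v::ordered_comm_monoid_add) \<Rightarrow> 'w::ordered_comm_monoid_add itself \<Rightarrow> bool" where
  "universal_OrdCMon H _ \<longleftrightarrow>
     baseless_entropy H \<and> initial_for (ord_cmon_hom :: ('v \<Rightarrow> 'w) \<Rightarrow> bool) H"

definition universal_COrdCMon ::
    "('a obj \<Rightarrow> 'v::ordered_comm_monoid_add) \<Rightarrow> 'w::ordered_comm_monoid_add itself \<Rightarrow> bool" where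
  "universal_COrdCMon H _ \<longleftrightarrow>
     cancellative TYPE('v) \<and> baseless_entropy H \<and>
     (cancellative TYPE('w) \<longrightarrow> initial_for (ord_cmon_hom :: ('v \<Rightarrow> 'w) \<Rightarrow> bool) H)"

definition universal_IcOrdCMon ::
    "('a obj \<Rightarrow> 'v::ordered_comm_monoid_add) \<Rightarrow> 'w::ordered_comm_monoid_add itself \<Rightarrow> bool" where
  "universal_IcOrdCMon H _ \<longleftrightarrow>
     integrally_closed TYPE('v) \<and> baseless_entropy H \<and>
     (integrally_closed TYPE('w) \<longrightarrow> initial_for (ord_cmon_hom :: ('v \<Rightarrow> 'w) \<Rightarrow> bool) H)"

definition universal_OrdAb ::
    "('a obj \<Rightarrow> 'v::ordered_ab_group_add) \<Rightarrow> 'w::ordered_ab_group_add itself \<Rightarrow> bool" where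
  "universal_OrdAb H _ \<longleftrightarrow>
     baseless_entropy H \<and> initial_for (ord_ab_hom :: ('v \<Rightarrow> 'w) \<Rightarrow> bool) H"

definition universal_IcOrdAb ::
    "('a obj \<Rightarrow> 'v::ordered_ab_group_add) \<Rightarrow> 'w::ordered_ab_group_add itself \<Rightarrow> bool" where
  "universal_IcOrdAb H _ \<longleftrightarrow>
     integrally_closed TYPE('v) \<and> baseless_entropy H \<and>
     (integrally_closed TYPE('w) \<longrightarrow> initial_for (ord_ab_hom :: ('v \<Rightarrow> 'w) \<Rightarrow> bool) H)"

definition universal_OrdVect ::
    "(rat \<Rightarrow> 'v \<Rightarrow> 'v) \<Rightarrow> ('a obj \<Rightarrow> 'v::ordered_ab_group_add) \<Rightarrow>
     'w::ordered_ab_group_add itself \<Rightarrow> bool" where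
  "universal_OrdVect s H _ \<longleftrightarrow>
     ordered_rat_vector_space s \<and> baseless_entropy H \<and>
     (\<forall>s' :: rat \<Rightarrow> 'w \<Rightarrow> 'w. ordered_rat_vector_space s' \<longrightarrow> initial_for (ord_vect_hom s s') H)"

definition universal_IcOrdVect ::
    "(rat \<Rightarrow> 'v \<Rightarrow> 'v) \<Rightarrow> ('a obj \<Rightarrow> 'v::ordered_ab_group_add) \<Rightarrow>
     'w::ordered_ab_group_add itself \<Rightarrow> bool" where
  "universal_IcOrdVect s H _ \<longleftrightarrow>
     ordered_rat_vector_space s \<and> integrally_closed TYPE('v) \<and> baseless_entropy H \<and>
     (\<forall>s' :: rat \<Rightarrow> 'w \<Rightarrow> 'w. ordered_rat_vector_space s' \<and> integrally_closed TYPE('w) \<longrightarrow>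
        initial_for (ord_vect_hom s s') H)"

end

(* By (3), h_P(X) depends only on the target A of X, so an entropy is its baseless entropy H, and the
   axioms make H monotone in cardinality with H(empty) = 0 and H(A + B) = H(A) + H(B). Hence
   H(A) = |A| x with x = H({a}) >= H(empty) = 0, and each universal property reduces to saying that
   1 freely generates the nonnegative integers, the integers or the rationals on a nonnegative
   element. *)
theory Submission
  imports Defs
begin

section \<open>Cardinality as an entropy\<close>

lemma tensor_ob_iff [simp]:
  "InL x \<in> tensor_ob A B \<longleftrightarrow> x \<in> A" "InR x \<in> tensor_ob A B \<longleftrightarrow> x \<in> B" "Atom a \<notin> tensor_ob A B"
  unfolding tensor_ob_def by auto

lemma card_tensor_ob:
  assumes "finite A" "finite B"
  shows "card (tensor_ob A B) = card A + card B"
proof -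
  have "card (tensor_ob A B) = card (InL ` A) + card (InR ` B)"
    unfolding tensor_ob_def using assms by (intro card_Un_disjoint) auto
  then show ?thesis
    by (simp add: card_image inj_on_def)
qed

text \<open>Morphisms under \<open>P\<close> are injections of the sources in reverse, a union is at
  most as large as its two parts together, \<open>precomp\<close> keeps the source set, and the
  tagged union is disjoint. The class of \<open>'v\<close> covers \<open>nat\<close>,
  \<open>int\<close> and \<open>rat\<close> at once.\<close>

lemma entropy_card:
  "entropy (\<lambda>(P :: 'a obj) X. of_nat (card (fst X)) :: 'v::linordered_semidom)"
proof -
  have "card (fst X') \<le> card (fst X)"
    if "X \<in> under_Ob P" "k \<in> under_Hom X X'" for P :: "'a obj" and X X' k
    using that by (intro card_inj_on_le[of k]) (auto simp: under_Ob_def under_Hom_def Hom_def Ob_def)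
  moreover have "card (fst (under_tensor X Y)) \<le> card (fst X) + card (fst Y)"
    if "X \<in> under_Ob P" "Y \<in> under_Ob P" for P :: "'a obj" and X Y
  proof -
    have "card (fst (under_tensor X Y)) \<le> card (snd X ` fst X) + card (snd Y ` fst Y)"
      unfolding under_tensor_def by (simp add: card_Un_le)
    also have "\<dots> \<le> card (fst X) + card (fst Y)"
      using that by (intro add_mono card_image_le) (auto simp: under_Ob_def Ob_def)
    finally show ?thesis .
  qed
  moreover have "card (fst (ext_tensor X Y)) = card (fst X) + card (fst Y)"
    if "X \<in> under_Ob P" "Y \<in> under_Ob Q" for P Q :: "'a obj" and X Y
    using that by (auto simp: ext_tensor_def card_tensor_ob under_Ob_def Ob_def)
  ultimately show ?thesis
    unfolding entropy_def
    by (auto simp: under_unit_def precomp_def simp flip: of_nat_add)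
qed

lemma baseless_entropy_card:
  "baseless_entropy (\<lambda>A :: 'a obj. of_nat (card A) :: 'v::linordered_semidom)"
  unfolding baseless_entropy_def
  using entropy_card by (auto simp: under_id_def intro!: exI)

lemma under_id_in_under_Ob: "P \<in> Ob \<Longrightarrow> under_id P \<in> under_Ob P"
  by (auto simp: under_id_def under_Ob_def Hom_def Id_def inj_on_def)

section \<open>Entropies as multiples of cardinality\<close>

context
  fixes h :: "'a obj \<Rightarrow> 'a under \<Rightarrow> 'w::ordered_comm_monoid_add" and H :: "'a obj \<Rightarrow> 'w"
  assumes h: "entropy h" and H: "\<And>P. P \<in> Ob \<Longrightarrow> H P = h P (under_id P)"
begin

text \<open>Every object \<open>(A, f)\<close> under \<open>P\<close> is the identity of
  \<open>A\<close> pulled back along \<open>f\<close>, so invariance under change of base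
  applies.\<close>

lemma entropy_eq_baseless:
  assumes "P \<in> Ob" "A \<in> Ob" "f \<in> Hom P A"
  shows "h P (A, f) = H A"
proof -
  \<comment> \<open>Composition restricts to \<open>A\<close>; the result is \<open>f\<close>
    because \<open>f\<close> is \<open>undefined\<close> outside \<open>A\<close>.\<close>
  have "precomp (under_id A) f = (A, f)"
    using assms by (auto simp: precomp_def under_id_def Comp_def Id_def compose_def Hom_def
        PiE_def extensional_def fun_eq_iff)
  moreover have "h P (precomp (under_id A) f) = h A (under_id A)"
    using h assms under_id_in_under_Ob unfolding entropy_def by blast
  ultimately show ?thesis
    using H assms by simp
qed

text \<open>An injection \<open>f\<close> from \<open>B\<close> to \<open>A\<close> serves twice: as
  the object \<open>(B, f)\<close> under \<open>A\<close>, and as a morphism to it from the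
  identity. Used in both directions, this gives equal values on sets of equal size.\<close>

lemma baseless_mono:
  assumes A: "finite A" and B: "finite B" and le: "card B \<le> card A"
  shows "H B \<le> H A"
proof -
  obtain g where g: "g ` B \<subseteq> A" "inj_on g B"
    using card_le_inj[OF B A le] by blast
  define f where "f = restrict g B"
  have f: "f \<in> Hom A B"
    using g unfolding f_def Hom_def by auto
  have "Comp B f (Id A) = f"
    using g by (auto simp: Comp_def Id_def compose_def f_def fun_eq_iff)
  then have "f \<in> under_Hom (under_id A) (B, f)"
    using f by (simp add: under_Hom_def under_id_def)
  moreover have "(B, f) \<in> under_Ob A"
    using f B by (simp add: under_Ob_def Ob_def)
  ultimately have "h A (B, f) \<le> h A (under_id A)"
    using h under_id_in_under_Ob[of A] A unfolding entropy_def Ob_def by blast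
  then show ?thesis
    using entropy_eq_baseless[OF _ _ f] H A B by (simp add: Ob_def)
qed

lemma baseless_empty: "H {} = 0"
proof -
  have "under_id {} = (under_unit :: 'a under)"
    by (simp add: under_id_def under_unit_def Id_def)
  then show ?thesis
    using h H[of "{}"] by (simp add: entropy_def unit_ob_def Ob_def)
qed

lemma baseless_tensor:
  assumes "finite A" "finite B"
  shows "H (tensor_ob A B) = H A + H B"
proof -
  have "ext_tensor (under_id A) (under_id B) = under_id (tensor_ob A B)"
    by (auto simp: ext_tensor_def under_id_def tensor_arr_def Id_def fun_eq_iff split: elem.splits)
  moreover have "h (tensor_ob A B) (ext_tensor (under_id A) (under_id B))
      = h A (under_id A) + h B (under_id B)"
    using h assms under_id_in_under_Ob unfolding entropy_def Ob_def by blast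
  moreover have "finite (tensor_ob A B)"
    using assms by (simp add: tensor_ob_def)
  ultimately show ?thesis
    using H assms by (simp add: Ob_def)
qed

text \<open>Induction on the cardinality, splitting off one element; \<open>Atom undefined\<close>
  is an arbitrary choice of a point.\<close>

lemma baseless_eq_multiple:
  assumes "finite A"
  shows "H A = (\<Sum>i<card A. H {Atom undefined})"
  using assms
proof (induction "card A" arbitrary: A)
  case 0
  then show ?case
    by (simp add: baseless_empty)
next
  case (Suc n)
  then obtain x B where xB: "A = insert x B" "x \<notin> B" "card B = n" "finite B"
    by (metis card_Suc_eq finite_insert)
  \<comment> \<open>\<open>A\<close> need not itself be a tensor product, so it is traded for one of
    the same size, on which additivity can act.\<close>
  have "card A = card (tensor_ob B {Atom undefined :: 'a elem})"
    using xB by (simp add: card_tensor_ob)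
  moreover have "finite (tensor_ob B {Atom undefined :: 'a elem})"
    using xB by (simp add: tensor_ob_def)
  ultimately have "H A = H (tensor_ob B {Atom undefined})"
    using Suc.prems by (intro antisym baseless_mono) auto
  also have "\<dots> = H B + H {Atom undefined}"
    using xB by (simp add: baseless_tensor)
  also have "\<dots> = (\<Sum>i<card A. H {Atom undefined})"
    using Suc.hyps(1)[of B] xB by (simp add: add.commute)
  finally show ?case .
qed

end

lemma baseless_entropy_multiple:
  fixes H :: "'a obj \<Rightarrow> 'w::ordered_comm_monoid_add"
  assumes "baseless_entropy H"
  obtains x where "0 \<le> x" "\<And>A. A \<in> Ob \<Longrightarrow> H A = (\<Sum>i<card A. x)"
proof -
  obtain h where h: "entropy h" "\<And>P. P \<in> Ob \<Longrightarrow> H P = h P (under_id P)"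
    using assms unfolding baseless_entropy_def by blast
  \<comment> \<open>Nonnegativity of the generator comes from comparing a singleton with the empty
    set.\<close>
  have "H {} \<le> H {Atom undefined}"
    by (rule baseless_mono[OF h]) simp_all
  then have "0 \<le> H {Atom undefined}"
    using baseless_empty[OF h] by simp
  moreover have "H A = (\<Sum>i<card A. H {Atom undefined})" if "A \<in> Ob" for A
    using that by (intro baseless_eq_multiple[OF h]) (simp_all add: Ob_def)
  ultimately show ?thesis
    by (rule that)
qed

section \<open>Reduction of universality to maps out of the natural numbers\<close>

lemma obtain_object_of_card:
  obtains A :: "'a obj" where "A \<in> Ob" "card A = n"
proof -
  have "\<exists>A :: 'a obj. finite A \<and> card A = n"
  proof (induction n)
    case 0
    show ?case
      by (rule exI[of _ "{}"]) simp
  next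
    case (Suc n)
    then obtain A :: "'a obj" where "finite A" "card A = n"
      by blast
    \<comment> \<open>The tags keep the new point apart from \<open>A\<close>, so every size occurs
      even if there is only one atom.\<close>
    then have "finite (tensor_ob A {Atom undefined}) \<and> card (tensor_ob A {Atom undefined}) = Suc n"
      by (simp add: card_tensor_ob) (simp add: tensor_ob_def)
    then show ?case ..
  qed
  then show ?thesis
    using that by (auto simp: Ob_def)
qed

text \<open>A baseless entropy amounts to some \<open>x \<ge> 0\<close>, and \<open>ex\<close>
  extends its multiples along \<open>c\<close>, the map from the naturals to the codomain. Since
  every natural number is a cardinality, compatibility with \<open>H'\<close> fixes a morphism on
  the image of \<open>c\<close>, and \<open>unique\<close> does the rest.\<close>

lemma initial_for_cardI:
  fixes Mor :: "('v \<Rightarrow> 'w::ordered_comm_monoid_add) \<Rightarrow> bool" and c :: "nat \<Rightarrow> 'v"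
  assumes ex: "\<And>x. 0 \<le> x \<Longrightarrow> \<exists>t. Mor t \<and> (\<forall>n. t (c n) = (\<Sum>i<n. x))"
    and unique: "\<And>t t'. Mor t \<Longrightarrow> Mor t' \<Longrightarrow> (\<And>n. t (c n) = t' (c n)) \<Longrightarrow> t = t'"
  shows "initial_for Mor (\<lambda>A :: 'a obj. c (card A))"
  unfolding initial_for_def
proof (intro allI impI)
  fix H' :: "'a obj \<Rightarrow> 'w"
  assume "baseless_entropy H'"
  then obtain x where x: "0 \<le> x" "\<And>A. A \<in> Ob \<Longrightarrow> H' A = (\<Sum>i<card A. x)"
    using baseless_entropy_multiple by blast
  obtain t where t: "Mor t" "\<And>n. t (c n) = (\<Sum>i<n. x)"
    using ex[OF x(1)] by blast
  show "\<exists>!t. Mor t \<and> (\<forall>P\<in>Ob. H' P = t (c (card P)))"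
  proof (rule ex1I[of _ t])
    show "Mor t \<and> (\<forall>P\<in>Ob. H' P = t (c (card P)))"
      using t x by simp
  next
    fix t' assume t': "Mor t' \<and> (\<forall>P\<in>Ob. H' P = t' (c (card P)))"
    show "t' = t"
    proof (rule unique)
      fix n
      obtain A :: "'a obj" where "A \<in> Ob" "card A = n"
        using obtain_object_of_card .
      then show "t' (c n) = t (c n)"
        using t t' x by metis
    qed (use t t' in auto)
  qed
qed

section \<open>Mapping properties of the naturals, integers and rationals\<close>

lemma sum_const_add:
  fixes x :: "'w::comm_monoid_add" and m n :: nat
  shows "(\<Sum>i<m + n. x) = (\<Sum>i<m. x) + (\<Sum>i<n. x)"
  by (induction n) (simp_all add: ac_simps)

lemma ord_cmon_hom_multiple:
  fixes x :: "'w::ordered_comm_monoid_add"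
  assumes "0 \<le> x"
  shows "ord_cmon_hom (\<lambda>n::nat. \<Sum>i<n. x)"
  unfolding ord_cmon_hom_def using assms
  by (auto simp: sum_const_add intro!: monoI sum_mono2)

lemma initial_for_nat:
  "initial_for (ord_cmon_hom :: (nat \<Rightarrow> 'w::ordered_comm_monoid_add) \<Rightarrow> bool) (\<lambda>A :: 'a obj. card A)"
  \<comment> \<open>Here \<open>c\<close> is the identity, so uniqueness is extensionality of
    functions.\<close>
  by (rule initial_for_cardI) (use ord_cmon_hom_multiple in blast, blast)

lemma ex_ord_ab_hom_int:
  fixes x :: "'w::ordered_ab_group_add"
  assumes "0 \<le> x"
  shows "\<exists>t. ord_ab_hom t \<and> (\<forall>n. t (int n) = (\<Sum>i<n. x))"
proof -
  \<comment> \<open>As \<open>nat\<close> sends negative integers to 0, at least one of the sums is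
    empty, and \<open>t z\<close> is the integer multiple of \<open>x\<close> by
    \<open>z\<close>.\<close>
  define t where "t z = (\<Sum>i<nat z. x) - (\<Sum>i<nat (- z). x)" for z
  \<comment> \<open>Any presentation as a difference may be used to compute \<open>t\<close>; this
    spares additivity a case split on signs.\<close>
  have t: "t (int m - int n) = (\<Sum>i<m. x) - (\<Sum>i<n. x)" for m n
  proof -
    \<comment> \<open>Both sides are the maximum of \<open>m\<close> and \<open>n\<close>.\<close>
    have "nat (int m - int n) + n = nat (- (int m - int n)) + m"
      by linarith
    then have "(\<Sum>i<nat (int m - int n). x) + (\<Sum>i<n. x)
        = (\<Sum>i<nat (- (int m - int n)). x) + (\<Sum>i<m. x)"
      by (metis sum_const_add)
    then show ?thesis
      unfolding t_def by (simp add: algebra_simps)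
  qed
  have add: "t (a + b) = t a + t b" for a b
  proof -
    obtain m n where a: "a = int m - int n" by (cases a rule: int_diff_cases)
    obtain m' n' where b: "b = int m' - int n'" by (cases b rule: int_diff_cases)
    have "a + b = int (m + m') - int (n + n')"
      using a b by simp
    then have "t (a + b) = (\<Sum>i<m + m'. x) - (\<Sum>i<n + n'. x)"
      by (metis t)
    then show ?thesis
      unfolding a b t by (simp add: sum_const_add)
  qed
  have "t a \<le> t b" if "a \<le> b" for a b
  proof -
    \<comment> \<open>Since \<open>b - a\<close> is nonnegative, the subtracted sum is
      empty.\<close>
    have "0 \<le> t (b - a)"
      using that assms by (simp add: t_def sum_nonneg)
    then show ?thesis
      using add[of a "b - a"] by simp
  qed
  then have "ord_ab_hom t"
    unfolding ord_ab_hom_def additive_def by (auto simp: add intro: monoI)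
  moreover have "t (int n) = (\<Sum>i<n. x)" for n
    using t[of n 0] by simp
  ultimately show ?thesis
    by blast
qed

text \<open>Every integer is a difference of naturals, and additive maps preserve
  differences.\<close>

lemma ord_ab_hom_int_unique:
  assumes t: "ord_ab_hom t" and t': "ord_ab_hom t'" and eq: "\<And>n. t (int n) = t' (int n)"
  shows "t = t'"
proof
  fix z :: int
  obtain m n where z: "z = int m - int n"
    by (cases z rule: int_diff_cases)
  interpret t: additive t using t by (simp add: ord_ab_hom_def)
  interpret t': additive t' using t' by (simp add: ord_ab_hom_def)
  show "t z = t' z"
    unfolding z t.diff t'.diff by (simp add: eq)
qed

lemma initial_for_int:
  "initial_for (ord_ab_hom :: (int \<Rightarrow> 'w::ordered_ab_group_add) \<Rightarrow> bool)
     (\<lambda>A :: 'a obj. int (card A))"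
  by (rule initial_for_cardI) (auto intro: ex_ord_ab_hom_int ord_ab_hom_int_unique)

lemma ordered_rat_vector_space_rat: "ordered_rat_vector_space ((*) :: rat \<Rightarrow> rat \<Rightarrow> rat)"
  by unfold_locales (auto simp: algebra_simps mult_left_mono)

text \<open>The morphism sending 1 to \<open>x\<close> is \<open>q \<mapsto> s q x\<close>, and a
  linear map on the rationals is determined by its value at 1.\<close>

lemma initial_for_rat:
  fixes s :: "rat \<Rightarrow> 'w \<Rightarrow> 'w::ordered_ab_group_add"
  assumes "ordered_rat_vector_space s"
  shows "initial_for (ord_vect_hom (*) s) (\<lambda>A :: 'a obj. rat_of_nat (card A))"
proof (rule initial_for_cardI)
  interpret W: ordered_rat_vector_space s by fact
  interpret V: ordered_rat_vector_space "(*) :: rat \<Rightarrow> rat \<Rightarrow> rat"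
    by (rule ordered_rat_vector_space_rat)
  fix x :: 'w assume x: "0 \<le> x"
  have "Vector_Spaces.linear (*) s (\<lambda>q. s q x)"
    by unfold_locales (simp_all add: W.scale_left_distrib)
  moreover have "s q x \<le> s r x" if "q \<le> r" for q r
  proof -
    \<comment> \<open>\<open>scale_mono\<close> compares vectors, not scalars, so it is applied to
      \<open>0 \<le> x\<close> with the nonnegative scalar \<open>r - q\<close>.\<close>
    have "s (r - q) 0 \<le> s (r - q) x"
      using that x by (intro W.scale_mono) auto
    then show ?thesis
      by (simp add: W.scale_left_diff_distrib)
  qed
  ultimately have "ord_vect_hom (*) s (\<lambda>q. s q x)"
    unfolding ord_vect_hom_def by (auto intro: monoI)
  moreover have "s (rat_of_nat n) x = (\<Sum>i<n. x)" for n
    by (induction n) (auto simp: W.scale_left_distrib ac_simps)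
  ultimately show "\<exists>t. ord_vect_hom (*) s t \<and> (\<forall>n. t (rat_of_nat n) = (\<Sum>i<n. x))"
    by blast
next
  fix t t' :: "rat \<Rightarrow> 'w"
  assume t: "ord_vect_hom (*) s t" and t': "ord_vect_hom (*) s t'"
    and eq: "\<And>n. t (rat_of_nat n) = t' (rat_of_nat n)"
  interpret t: Vector_Spaces.linear "(*)" s t using t by (simp add: ord_vect_hom_def)
  interpret t': Vector_Spaces.linear "(*)" s t' using t' by (simp add: ord_vect_hom_def)
  show "t = t'"
  proof
    fix q
    show "t q = t' q"
      using t.scale[of q 1] t'.scale[of q 1] eq[of 1] by simp
  qed
qed

section \<open>Integral closure from the Archimedean property\<close>

lemma integrally_closed_if_embeds:
  fixes e :: "'v::ordered_comm_monoid_add \<Rightarrow> 'k::archimedean_field"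
  assumes add: "\<And>x y. e (x + y) = e x + e y" and le: "\<And>x y. e x \<le> e y \<longleftrightarrow> x \<le> y"
  shows "integrally_closed TYPE('v)"
  unfolding integrally_closed_def
proof (intro allI impI)
  fix x y a b :: 'v
  assume *: "\<forall>n::nat. n \<ge> 1 \<longrightarrow> (\<Sum>i<n. x) + a \<ge> (\<Sum>i<n. y) + b"
  have "e 0 = 0"
    using add[of 0 0] by simp
  then have e_sum: "e (\<Sum>i<n. z) = of_nat n * e z" for n and z :: 'v
    by (induction n) (simp_all add: add algebra_simps)
  show "y \<le> x"
  proof (rule ccontr)
    assume "\<not> y \<le> x"
    \<comment> \<open>The order of the field is linear, so the failure of \<open>y \<le> x\<close>
      becomes a strict inequality there.\<close>
    then have "0 < e y - e x"
      using le by (simp add: not_le[symmetric])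
    \<comment> \<open>By \<open>*\<close>, positive multiples of \<open>e y - e x\<close> stay below
      \<open>e a - e b\<close>; the Archimedean property contradicts this.\<close>
    then obtain n where n: "e a - e b < of_nat n * (e y - e x)"
      using ex_less_of_nat_mult by blast
    \<comment> \<open>\<open>n\<close> may be 0 while \<open>*\<close> starts at 1, hence the
      passage to \<open>Suc n\<close>.\<close>
    have "of_nat n * (e y - e x) \<le> of_nat (Suc n) * (e y - e x)"
      using \<open>0 < e y - e x\<close> by (intro mult_right_mono) auto
    moreover have "e ((\<Sum>i<Suc n. y) + b) \<le> e ((\<Sum>i<Suc n. x) + a)"
      using *[rule_format, of "Suc n"] by (simp only: le)
    then have "of_nat (Suc n) * (e y - e x) \<le> e a - e b"
      unfolding add e_sum right_diff_distrib by (simp add: algebra_simps)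
    ultimately show False
      using n by simp
  qed
qed

theorem proposition22:
  shows "(universal_OrdCMon (\<lambda>A :: 'a obj. card A) TYPE('m::ordered_comm_monoid_add) \<and>
          universal_COrdCMon (\<lambda>A :: 'a obj. card A) TYPE('m) \<and>
          universal_IcOrdCMon (\<lambda>A :: 'a obj. card A) TYPE('m)) \<and>
         (universal_OrdAb (\<lambda>A :: 'a obj. int (card A)) TYPE('g::ordered_ab_group_add) \<and>
          universal_IcOrdAb (\<lambda>A :: 'a obj. int (card A)) TYPE('g)) \<and>
         (universal_OrdVect (*) (\<lambda>A :: 'a obj. rat_of_nat (card A)) TYPE('q::ordered_ab_group_add) \<and>
          universal_IcOrdVect (*) (\<lambda>A :: 'a obj. rat_of_nat (card A)) TYPE('q))"
proof -
  \<comment> \<open>A full subcategory has the same morphisms, so initiality carries over once the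
    target is known to lie in it.\<close>
  have "cancellative TYPE(nat)"
    by (simp add: cancellative_def)
  moreover have "integrally_closed TYPE(nat)"
    by (rule integrally_closed_if_embeds[of rat_of_nat]) auto
  moreover have "integrally_closed TYPE(int)"
    by (rule integrally_closed_if_embeds[of rat_of_int]) auto
  moreover have "integrally_closed TYPE(rat)"
    by (rule integrally_closed_if_embeds[of "\<lambda>q. q"]) auto
  moreover have "baseless_entropy (\<lambda>A :: 'a obj. card A)"
    using baseless_entropy_card[where 'v = nat] by simp
  ultimately show ?thesis
    unfolding universal_OrdCMon_def universal_COrdCMon_def universal_IcOrdCMon_def
      universal_OrdAb_def universal_IcOrdAb_def universal_OrdVect_def universal_IcOrdVect_def
    using baseless_entropy_card[where 'v = int] baseless_entropy_card[where 'v = rat]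
      initial_for_nat initial_for_int initial_for_rat ordered_rat_vector_space_rat
    by blast
qed

end
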